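(* Let $\mathfrak{L}$ be a supersolvable left Leibniz algebra over an algebraically closed field $\mathbb{F}$, and let $M$ be a finite-dimensional $\mathfrak{L}$-bimodule. If no composition factor of $M$ is one-dimensional, then $$\mathrm{HL}^n(\mathfrak{L},M)\cong\begin{cases}M_0&\text{if }n=0,\\0&\text{if }n\ge 1.\end{cases}$$ Moreover, if $M$ is symmetric, then $\mathrm{HL}^n(\mathfrak{L},M)=0$ for every non-negative integer $n$.
   Context: A left Leibniz algebra over a field $\mathbb{F}$ is an $\mathbb{F}$-vector space $\mathfrak{L}$ with a bilinear multiplication satisfying $x(yz)=(xy)z+y(xz)$ for all $x,y,z\in\mathfrak{L}$. Ideals are two-sided. $\mathfrak{L}$ is supersolvable if there is a chain $\mathfrak{L}=\mathfrak{L}_k\supset\mathfrak{L}_{k-1}\supset\cdots\supset\mathfrak{L}_1\supset\mathfrak{L}_0=0$ of ideals of $\mathfrak{L}$ with $\dim_{\mathbb{F}}\mathfrak{L}_j/\mathfrak{L}_{j-1}=1$ for $1\le j\le k$. An $\mathfrak{L}$-bimodule is an $\mathbb{F}$-vector space $M$ with bilinear left and right actions of $\mathfrak{L}$ such that $(xy)\cdot m=x\cdot(y\cdot m)-y\cdot(x\cdot m)$, $(x\cdot m)\cdot y=x\cdot(m\cdot y)-m\cdot(xy)$, and $(m\cdot x)\cdot y=m\cdot(xy)-x\cdot(m\cdot y)$ for all $m\in M$, $x,y\in\mathfrak{L}$. $M$ is symmetric if $m\cdot x=-x\cdot m$ for all $x\in\mathfrak{L}$, $m\in M$. Composition factors are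 taken in the category of $\mathfrak{L}$-bimodules. $M_0:=\langle x\cdot m+m\cdot x\mid x\in\mathfrak{L},m\in M\rangle_{\mathbb{F}}$. Leibniz cohomology: for $n\ge 0$ let $\mathrm{CL}^n(\mathfrak{L},M):=\mathrm{Hom}_{\mathbb{F}}(\mathfrak{L}^{\otimes n},M)$ and $\mathrm{d}^n:\mathrm{CL}^n(\mathfrak{L},M)\to\mathrm{CL}^{n+1}(\mathfrak{L},M)$, $$(\mathrm{d}^nf)(x_1\otimes\dots\otimes x_{n+1})=\sum_{j=1}^n(-1)^{j+1}x_j\cdot f(x_1\otimes\dots\otimes\hat{x}_j\otimes\dots\otimes x_{n+1})+(-1)^{n+1}f(x_1\otimes\dots\otimes x_n)\cdot x_{n+1}+\sum_{1\le i<j\le n+1}(-1)^if(x_1\otimes\dots\otimes\hat{x}_i\otimes\dots\otimes x_{j-1}\otimes x_ix_j\otimes x_{j+1}\otimes\dots\otimes x_{n+1}).$$ This is a cochain complex, and $\mathrm{HL}^n(\mathfrak{L},M):=\operatorname{Ker}(\mathrm{d}^n)/\operatorname{Im}(\mathrm{d}^{n-1})$ with $\mathrm{d}^{-1}:=0$. *)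

theory Defs
  imports
    "HOL-Computational_Algebra.Polynomial"
    "HOL-Library.Function_Algebras"
begin

section \<open>Subquotients of vector spaces\<close>

text \<open>
  Ambient vector spaces are types with a scalar multiplication, as in the library locale
  \<^locale>\<open>vector_space\<close>. Subspaces and quotients are not types, so they are
  carried by the following record; quotient spaces have honest cosets as elements.
\<close>

record ('f, 'v) vspace =
  vcarrier :: "'v set"
  vzero :: 'v
  vadd :: "'v \<Rightarrow> 'v \<Rightarrow> 'v"
  vscale :: "'f \<Rightarrow> 'v \<Rightarrow> 'v"

definition vspace_of :: "('f::field \<Rightarrow> 'v::ab_group_add \<Rightarrow> 'v) \<Rightarrow> 'v set \<Rightarrow> ('f, 'v) vspace" where
  "vspace_of s U = \<lparr>vcarrier = U, vzero = 0, vadd = (+), vscale = s\<rparr>"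

definition coset :: "'v::ab_group_add set \<Rightarrow> 'v \<Rightarrow> 'v set" where
  "coset W u = {u + w | w. w \<in> W}"

text \<open>
  The quotient \<open>U / W\<close>. The summand from \<open>W\<close> in the scalar multiplication matters only
  for the scalar zero; the lemmas below confirm that these are the usual operations.
\<close>

definition quotient_vspace ::
  "('f::field \<Rightarrow> 'v::ab_group_add \<Rightarrow> 'v) \<Rightarrow> 'v set \<Rightarrow> 'v set \<Rightarrow> ('f, 'v set) vspace" where
  "quotient_vspace s U W =
     \<lparr>vcarrier = coset W ` U,
      vzero = W,
      vadd = (\<lambda>A B. {a + b | a b. a \<in> A \<and> b \<in> B}),
      vscale = (\<lambda>c A. {s c a + w | a w. a \<in> A \<and> w \<in> W})\<rparr>"

context vector_space
begin

lemma quotient_vspace_add: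
  assumes "subspace W"
  shows "vadd (quotient_vspace scale U W) (coset W u) (coset W v) = coset W (u + v)"
proof -
  have "\<exists>a b. u + v + w = a + b \<and> a \<in> coset W u \<and> b \<in> coset W v" if "w \<in> W" for w
    by (rule exI[of _ "u + w"], rule exI[of _ v])
      (use that subspace_0[OF assms] in \<open>auto simp: coset_def algebra_simps\<close>)
  moreover have "\<exists>w. u + w1 + (v + w2) = u + v + w \<and> w \<in> W" if "w1 \<in> W" "w2 \<in> W" for w1 w2
    using subspace_add[OF assms that] by (auto simp: algebra_simps)
  ultimately show ?thesis
    by (fastforce simp: quotient_vspace_def coset_def)
qed

lemma quotient_vspace_scale:
  assumes "subspace W"
  shows "vscale (quotient_vspace scale U W) c (coset W u) = coset W (scale c u)"
proof -
  have "\<exists>a w'. scale c u + w = scale c a + w' \<and> a \<in> coset W u \<and> w' \<in> W" if "w \<in> W" for w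
    by (rule exI[of _ u], rule exI[of _ w])
      (use that subspace_0[OF assms] in \<open>auto simp: coset_def\<close>)
  moreover have "\<exists>w. scale c (u + w1) + w2 = scale c u + w \<and> w \<in> W"
    if "w1 \<in> W" "w2 \<in> W" for w1 w2
    using subspace_add[OF assms subspace_scale[OF assms that(1)] that(2)]
    by (auto simp: scale_right_distrib add.assoc)
  ultimately show ?thesis
    by (fastforce simp: quotient_vspace_def coset_def)
qed

end

definition vspace_iso :: "('f, 'v) vspace \<Rightarrow> ('f, 'w) vspace \<Rightarrow> bool" (infix \<open>\<cong>\<^sub>V\<close> 50) where
  "V \<cong>\<^sub>V W \<longleftrightarrow>
     (\<exists>\<phi>. bij_betw \<phi> (vcarrier V) (vcarrier W) \<and>
          (\<forall>a\<in>vcarrier V. \<forall>b\<in>vcarrier V. \<phi> (vadd V a b) = vadd W (\<phi> a) (\<phi> b)) \<and>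
          (\<forall>c. \<forall>a\<in>vcarrier V. \<phi> (vscale V c a) = vscale W c (\<phi> a)))"

definition is_zero_vspace :: "('f, 'v) vspace \<Rightarrow> bool" where
  "is_zero_vspace V \<longleftrightarrow> vcarrier V = {vzero V}"

text \<open>The coordinate space of \<open>n\<close>-tuples, realised as sequences vanishing from index \<open>n\<close> on.\<close>

definition coordinate_vspace :: "nat \<Rightarrow> ('f::field, nat \<Rightarrow> 'f) vspace" where
  "coordinate_vspace n = vspace_of (\<lambda>c v i. c * v i) {v. \<forall>i\<ge>n. v i = 0}"

definition has_dim :: "('f::field, 'v) vspace \<Rightarrow> nat \<Rightarrow> bool" where
  "has_dim V n \<longleftrightarrow> V \<cong>\<^sub>V (coordinate_vspace n :: ('f, nat \<Rightarrow> 'f) vspace)"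

definition bilinear_map ::
  "('f::field \<Rightarrow> 'a::ab_group_add \<Rightarrow> 'a) \<Rightarrow> ('f \<Rightarrow> 'b::ab_group_add \<Rightarrow> 'b) \<Rightarrow>
   ('f \<Rightarrow> 'c::ab_group_add \<Rightarrow> 'c) \<Rightarrow> ('a \<Rightarrow> 'b \<Rightarrow> 'c) \<Rightarrow> bool" where
  "bilinear_map sa sb sc f \<longleftrightarrow>
     (\<forall>a. Vector_Spaces.linear sb sc (f a)) \<and> (\<forall>b. Vector_Spaces.linear sa sc (\<lambda>a. f a b))"

section \<open>Left Leibniz algebras\<close>

locale left_leibniz_algebra = L: vector_space scaleL
  for scaleL :: "'f::field \<Rightarrow> 'l::ab_group_add \<Rightarrow> 'l" +
  fixes mult :: "'l \<Rightarrow> 'l \<Rightarrow> 'l"  (infixl \<open>\<cdot>\<close> 70)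
  assumes bilinear_mult: "bilinear_map scaleL scaleL scaleL (\<cdot>)"
    and left_leibniz: "x \<cdot> (y \<cdot> z) = (x \<cdot> y) \<cdot> z + y \<cdot> (x \<cdot> z)"
begin

definition ideal :: "'l set \<Rightarrow> bool" where
  "ideal I \<longleftrightarrow> L.subspace I \<and> (\<forall>x. \<forall>a\<in>I. x \<cdot> a \<in> I \<and> a \<cdot> x \<in> I)"

definition supersolvable :: bool where
  "supersolvable \<longleftrightarrow>
     (\<exists>k (I :: nat \<Rightarrow> 'l set).
        I k = UNIV \<and> I 0 = {0} \<and> (\<forall>j\<le>k. ideal (I j)) \<and>
        (\<forall>j\<in>{1..k}. I (j - 1) \<subset> I j \<and> has_dim (quotient_vspace scaleL (I j) (I (j - 1))) 1))"

end

section \<open>Bimodules\<close>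

locale leibniz_bimodule =
  left_leibniz_algebra scaleL mult + M: vector_space scaleM
  for scaleL :: "'f::field \<Rightarrow> 'l::ab_group_add \<Rightarrow> 'l"
    and mult :: "'l \<Rightarrow> 'l \<Rightarrow> 'l"  (infixl \<open>\<cdot>\<close> 70)
    and scaleM :: "'f \<Rightarrow> 'm::ab_group_add \<Rightarrow> 'm" +
  fixes lact :: "'l \<Rightarrow> 'm \<Rightarrow> 'm"  (infixr \<open>\<rhd>\<close> 70)
    and ract :: "'m \<Rightarrow> 'l \<Rightarrow> 'm"  (infixl \<open>\<lhd>\<close> 70)
  assumes bilinear_lact: "bilinear_map scaleL scaleM scaleM (\<rhd>)"
    and bilinear_ract: "bilinear_map scaleM scaleL scaleM (\<lhd>)"
    and LLM: "(x \<cdot> y) \<rhd> m = x \<rhd> (y \<rhd> m) - y \<rhd> (x \<rhd> m)"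
    and LML: "(x \<rhd> m) \<lhd> y = x \<rhd> (m \<lhd> y) - m \<lhd> (x \<cdot> y)"
    and MLL: "(m \<lhd> x) \<lhd> y = m \<lhd> (x \<cdot> y) - x \<rhd> (m \<lhd> y)"
begin

definition symmetric :: bool where
  "symmetric \<longleftrightarrow> (\<forall>x m. m \<lhd> x = - (x \<rhd> m))"

definition M0 :: "'m set" where
  "M0 = M.span {x \<rhd> m + m \<lhd> x | x m. True}"

definition subbimodule :: "'m set \<Rightarrow> bool" where
  "subbimodule N \<longleftrightarrow> M.subspace N \<and> (\<forall>x. \<forall>m\<in>N. x \<rhd> m \<in> N \<and> m \<lhd> x \<in> N)"

text \<open>
  A composition series is a finite strict chain of sub-bimodules that cannot be refined.
  The composition factors are recorded with their vector space structure only.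
\<close>

definition composition_series :: "nat \<Rightarrow> (nat \<Rightarrow> 'm set) \<Rightarrow> bool" where
  "composition_series k N \<longleftrightarrow>
     N 0 = {0} \<and> N k = UNIV \<and> (\<forall>j\<le>k. subbimodule (N j)) \<and>
     (\<forall>j\<in>{1..k}. N (j - 1) \<subset> N j \<and> \<not> (\<exists>P. subbimodule P \<and> N (j - 1) \<subset> P \<and> P \<subset> N j))"

definition composition_factors :: "('f, 'm set) vspace set" where
  "composition_factors =
     {quotient_vspace scaleM (N j) (N (j - 1)) | N j k. composition_series k N \<and> j \<in> {1..k}}"

section \<open>Leibniz cohomology\<close>

text \<open>
  By the universal property of the tensor power, \<open>n\<close>-cochains are the \<open>n\<close>-fold multilinear
  maps from the algebra to the bimodule. They are functions on lists of length \<open>n\<close>, extended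
  by \<open>0\<close> to lists of other lengths so that every multilinear map has exactly one representative.
\<close>

definition CL :: "nat \<Rightarrow> ('l list \<Rightarrow> 'm) set" where
  "CL n =
     {f. (\<forall>xs. length xs \<noteq> n \<longrightarrow> f xs = 0) \<and>
         (\<forall>xs. length xs = n \<longrightarrow> (\<forall>i<n. Vector_Spaces.linear scaleL scaleM (\<lambda>x. f (xs[i := x]))))}"

definition scaleCL :: "'f \<Rightarrow> ('l list \<Rightarrow> 'm) \<Rightarrow> 'l list \<Rightarrow> 'm" where
  "scaleCL c f = (\<lambda>xs. scaleM c (f xs))"

definition omit :: "nat \<Rightarrow> 'l list \<Rightarrow> 'l list" where
  "omit i xs = take i xs @ drop (Suc i) xs"

text \<open>
  List positions start at \<open>0\<close>, so the entry \<open>x\<^sub>j\<close> of the usual formula is \<open>xs ! (j - 1)\<close>. With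
  positions \<open>i, j\<close> counted from \<open>0\<close>, the sign \<open>(-1)\<^sup>j\<^sup>+\<^sup>1\<close> of the first sum becomes \<open>(-1)\<^sup>j\<close> and
  the sign \<open>(-1)\<^sup>i\<close> of the last sum becomes \<open>(-1)\<^sup>i\<^sup>+\<^sup>1\<close>.
\<close>

definition d :: "nat \<Rightarrow> ('l list \<Rightarrow> 'm) \<Rightarrow> 'l list \<Rightarrow> 'm" where
  "d n f = (\<lambda>xs.
     if length xs = n + 1 then
       (\<Sum>j<n. scaleM ((-1) ^ j) ((xs ! j) \<rhd> f (omit j xs)))
       + scaleM ((-1) ^ (n + 1)) (f (take n xs) \<lhd> (xs ! n))
       + (\<Sum>j\<le>n. \<Sum>i<j. scaleM ((-1) ^ (i + 1)) (f (omit i (xs[j := (xs ! i) \<cdot> (xs ! j)]))))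
     else 0)"

definition cocycles :: "nat \<Rightarrow> ('l list \<Rightarrow> 'm) set" where
  "cocycles n = {f \<in> CL n. d n f = 0}"

definition coboundaries :: "nat \<Rightarrow> ('l list \<Rightarrow> 'm) set" where
  "coboundaries n = (if n = 0 then {0} else d (n - 1) ` CL (n - 1))"

definition HL :: "nat \<Rightarrow> ('f, ('l list \<Rightarrow> 'm) set) vspace" where
  "HL n = quotient_vspace scaleCL (cocycles n) (coboundaries n)"

end

end

theory Submission
  imports Defs
begin

text \<open>
  The algebra acts on cochains by operators \<open>\<theta> x\<close> that commute with the differential, and in
  positive degrees Cartan's formula \<open>\<theta> x = d \<circ> i x + i x \<circ> d\<close> shows that this action is trivial
  on cohomology. If \<open>M\<close> has no one-dimensional composition factor, then neither does it have a
  one-dimensional subquotient as a left module. Filtering the space of \<open>n\<close>-cochains along the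
  flag of ideals, whose factors are one-dimensional, shows that its layers are twists of the space
  of \<open>(n - 1)\<close>-cochains by characters, so it has no one-dimensional subquotient either. A cocycle
  that is not a coboundary would however span one modulo the coboundaries.
  In degree \<open>0\<close> the cohomology consists of the right invariants; they contain \<open>M0\<close>, and an
  invariant outside \<open>M0\<close> would span a one-dimensional sub-bimodule modulo \<open>M0\<close>.
\<close>

text \<open>
  No one-dimensional subquotient \<open>(W + F v) / W\<close>, where \<open>\<mu>\<close> is its weight. No linearity of
  \<open>\<mu>\<close> is imposed, so that twisting by a character does not affect the notion.
\<close>

definition weight_free ::
  "('f::field \<Rightarrow> 'v::ab_group_add \<Rightarrow> 'v) \<Rightarrow> ('l \<Rightarrow> 'v \<Rightarrow> 'v) \<Rightarrow> 'v set \<Rightarrow> bool" where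
  "weight_free s act V \<longleftrightarrow>
     (\<forall>W \<mu> v. module.subspace s W \<longrightarrow> (\<forall>x. \<forall>w\<in>W. act x w \<in> W) \<longrightarrow> v \<in> V \<longrightarrow>
        (\<forall>x. act x v - s (\<mu> x) v \<in> W) \<longrightarrow> v \<in> W)"

section \<open>One-dimensional quotients in terms of a spanning vector\<close>

context vector_space
begin

lemma coset_eq_iff:
  assumes "subspace W"
  shows "coset W u = coset W v \<longleftrightarrow> u - v \<in> W"
proof
  assume "coset W u = coset W v"
  moreover have "u \<in> coset W u"
    using subspace_0[OF assms] by (force simp: coset_def)
  ultimately show "u - v \<in> W"
    by (auto simp: coset_def)
next
  assume uv: "u - v \<in> W"
  have "coset W a \<subseteq> coset W b" if "a - b \<in> W" for a b
  proof
    fix z assume "z \<in> coset W a"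
    then obtain w where w: "w \<in> W" "z = a + w"
      by (auto simp: coset_def)
    then have "z = b + ((a - b) + w)" "(a - b) + w \<in> W"
      using that subspace_add[OF assms] by auto
    then show "z \<in> coset W b"
      unfolding coset_def by blast
  qed
  from this[OF uv] this[of v u] show "coset W u = coset W v"
    using subspace_neg[OF assms uv] by auto
qed

text \<open>The vector \<open>e\<close> represents the coset sent to the unit vector by the
  coordinate isomorphism. It is what the layers of the flag of ideals supply later on.\<close>

lemma has_dim_quotient_oneE:
  assumes W: "subspace W" and U: "subspace U" and dim: "has_dim (quotient_vspace scale U W) 1"
  obtains e where "e \<in> U" "\<And>u. u \<in> U \<Longrightarrow> \<exists>c. u - scale c e \<in> W"
proof -
  let ?Q = "quotient_vspace scale U W"
  let ?C = "coordinate_vspace 1 :: ('a, nat \<Rightarrow> 'a) vspace"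
  obtain \<phi> where bij: "bij_betw \<phi> (vcarrier ?Q) (vcarrier ?C)"
    and sc: "\<And>c A. A \<in> vcarrier ?Q \<Longrightarrow> \<phi> (vscale ?Q c A) = vscale ?C c (\<phi> A)"
    using dim unfolding has_dim_def vspace_iso_def by blast
  have carrier: "vcarrier ?Q = coset W ` U"
    by (simp add: quotient_vspace_def)
  have "(\<lambda>i::nat. if i = 0 then 1 else 0) \<in> vcarrier ?C"
    by (simp add: coordinate_vspace_def vspace_of_def)
  then obtain e where e: "e \<in> U" "\<phi> (coset W e) = (\<lambda>i::nat. if i = 0 then 1 else 0)"
    using bij carrier unfolding bij_betw_def by (metis (no_types, lifting) imageE)
  have "\<exists>c. u - scale c e \<in> W" if u: "u \<in> U" for u
  proof -
    \<comment> \<open>The coset of \<open>u\<close> is determined by its only coordinate, the entry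
      at index 0.\<close>
    let ?c = "\<phi> (coset W u) 0"
    have uQ: "coset W u \<in> vcarrier ?Q" "coset W e \<in> vcarrier ?Q"
      using u e(1) carrier by auto
    have ceQ: "coset W (scale ?c e) \<in> vcarrier ?Q"
      using subspace_scale[OF U e(1)] carrier by auto
    have "\<phi> (coset W u) \<in> vcarrier ?C"
      using bij uQ(1) bij_betwE by blast
    then have "\<phi> (coset W u) = vscale ?C ?c (\<phi> (coset W e))"
      unfolding e(2) by (auto simp: coordinate_vspace_def vspace_of_def)
    also have "\<dots> = \<phi> (coset W (scale ?c e))"
      using sc[OF uQ(2)] quotient_vspace_scale[OF W] by metis
    finally have "coset W u = coset W (scale ?c e)"
      using bij uQ(1) ceQ unfolding bij_betw_def inj_on_def by blast
    then show ?thesis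
      using coset_eq_iff[OF W] by blast
  qed
  with e(1) that show thesis by blast
qed

lemma has_dim_quotient_oneI:
  assumes W: "subspace W" and v: "v \<notin> W"
  shows "has_dim (quotient_vspace scale {w + scale c v | w c. w \<in> W} W) 1"
proof -
  let ?U = "{w + scale c v | w c. w \<in> W}"
  let ?Q = "quotient_vspace scale ?U W"
  let ?C = "coordinate_vspace 1 :: ('a, nat \<Rightarrow> 'a) vspace"
  have carrier: "vcarrier ?Q = range (\<lambda>c. coset W (scale c v))"
  proof -
    have "coset W (w + scale c v) = coset W (scale c v)" if "w \<in> W" for w c
      using that coset_eq_iff[OF W] by simp
    moreover have "scale c v \<in> ?U" for c
      using subspace_0[OF W] by force
    ultimately show ?thesis
      unfolding quotient_vspace_def by (auto intro!: image_eqI)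
  qed
  have inj: "c = c'" if "coset W (scale c v) = coset W (scale c' v)" for c c'
  proof (rule ccontr)
    assume "c \<noteq> c'"
    have "scale (c - c') v \<in> W"
      using that coset_eq_iff[OF W] by (simp add: scale_left_diff_distrib)
    from subspace_scale[OF W this, of "inverse (c - c')"] have "v \<in> W"
      using \<open>c \<noteq> c'\<close> by simp
    with v show False ..
  qed
  \<comment> \<open>The description picks the coefficient of \<open>v\<close>, unique by
    \<open>inj\<close>; sequences in the coordinate line vanish away from index 0.\<close>
  define \<phi> :: "'b set \<Rightarrow> nat \<Rightarrow> 'a"
    where "\<phi> A = (\<lambda>i. if i = 0 then THE c. A = coset W (scale c v) else 0)" for A
  have \<phi>: "\<phi> (coset W (scale c v)) = (\<lambda>i. if i = 0 then c else 0)" for c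
  proof -
    have "(THE c'. coset W (scale c v) = coset W (scale c' v)) = c"
      by (rule the_equality) (auto dest: inj)
    then show ?thesis by (auto simp: \<phi>_def fun_eq_iff)
  qed
  have "bij_betw \<phi> (vcarrier ?Q) (vcarrier ?C)"
    unfolding bij_betw_def
  proof
    show "inj_on \<phi> (vcarrier ?Q)"
    proof (rule inj_onI)
      fix A B assume "A \<in> vcarrier ?Q" "B \<in> vcarrier ?Q" and eq: "\<phi> A = \<phi> B"
      then obtain a b where "A = coset W (scale a v)" "B = coset W (scale b v)"
        unfolding carrier by blast
      with fun_cong[OF eq, of 0] show "A = B" by (simp add: \<phi>)
    qed
    have "f \<in> \<phi> ` vcarrier ?Q" if "f \<in> vcarrier ?C" for f
    proof
      show "f = \<phi> (coset W (scale (f 0) v))"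
        using that by (auto simp: \<phi> coordinate_vspace_def vspace_of_def)
      show "coset W (scale (f 0) v) \<in> vcarrier ?Q"
        unfolding carrier by blast
    qed
    then show "\<phi> ` vcarrier ?Q = vcarrier ?C"
      unfolding carrier by (auto simp: \<phi> coordinate_vspace_def vspace_of_def)
  qed
  moreover have "\<phi> (vadd ?Q A B) = vadd ?C (\<phi> A) (\<phi> B)"
    if AB: "A \<in> vcarrier ?Q" "B \<in> vcarrier ?Q" for A B
  proof -
    obtain a b where "A = coset W (scale a v)" "B = coset W (scale b v)"
      using AB unfolding carrier by blast
    then show ?thesis
      using \<phi>[of "a + b"]
      by (auto simp: \<phi> quotient_vspace_add[OF W] scale_left_distrib
          coordinate_vspace_def vspace_of_def)
  qed
  moreover have "\<phi> (vscale ?Q c A) = vscale ?C c (\<phi> A)" if A: "A \<in> vcarrier ?Q" for c A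
  proof -
    obtain a where "A = coset W (scale a v)"
      using A unfolding carrier by blast
    then show ?thesis
      using \<phi>[of "c * a"]
      by (auto simp: \<phi> quotient_vspace_scale[OF W] coordinate_vspace_def vspace_of_def)
  qed
  ultimately show ?thesis
    unfolding has_dim_def vspace_iso_def by blast
qed

lemma weight_freeD:
  assumes "weight_free scale act V" "subspace W" "\<And>x w. w \<in> W \<Longrightarrow> act x w \<in> W" "v \<in> V"
    "\<And>x. act x v - scale (\<mu> x) v \<in> W"
  shows "v \<in> W"
  using assms unfolding weight_free_def by blast

end

context left_leibniz_algebra
begin

definition one_dim_flag :: "nat \<Rightarrow> (nat \<Rightarrow> 'l set) \<Rightarrow> bool" where
  "one_dim_flag k I \<longleftrightarrow> I k = UNIV \<and> I 0 = {0} \<and> (\<forall>j\<le>k. ideal (I j)) \<and>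
     (\<forall>j\<in>{1..k}. I (j - 1) \<subset> I j \<and> has_dim (quotient_vspace scaleL (I j) (I (j - 1))) 1)"

lemma supersolvable_iff: "supersolvable \<longleftrightarrow> (\<exists>k I. one_dim_flag k I)"
  by (simp only: supersolvable_def one_dim_flag_def)

end

section \<open>Bilinearity rules and the sub-bimodule \<open>M0\<close>\<close>

context leibniz_bimodule
begin

lemma bilinear_simps [simp]:
  "(x + y) \<rhd> m = x \<rhd> m + y \<rhd> m" "x \<rhd> (m + m') = x \<rhd> m + x \<rhd> m'"
  "scaleL c x \<rhd> m = scaleM c (x \<rhd> m)" "x \<rhd> scaleM c m = scaleM c (x \<rhd> m)"
  "m \<lhd> (x + y) = m \<lhd> x + m \<lhd> y" "(m + m') \<lhd> x = m \<lhd> x + m' \<lhd> x"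
  "m \<lhd> scaleL c x = scaleM c (m \<lhd> x)" "scaleM c m \<lhd> x = scaleM c (m \<lhd> x)"
  "(x + y) \<cdot> z = x \<cdot> z + y \<cdot> z" "z \<cdot> (x + y) = z \<cdot> x + z \<cdot> y"
  "scaleL c x \<cdot> y = scaleL c (x \<cdot> y)" "x \<cdot> scaleL c y = scaleL c (x \<cdot> y)"
  using bilinear_lact bilinear_ract bilinear_mult
  unfolding bilinear_map_def Vector_Spaces.linear_iff by auto

lemma act_zero_minus [simp]:
  "x \<rhd> 0 = 0" "x \<rhd> (- m) = - (x \<rhd> m)" "x \<rhd> (m - m') = x \<rhd> m - x \<rhd> m'"
  "0 \<lhd> x = 0" "(- m) \<lhd> x = - (m \<lhd> x)" "(m - m') \<lhd> x = m \<lhd> x - m' \<lhd> x"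
proof -
  show 1: "x \<rhd> 0 = 0" "0 \<lhd> x = 0" for x
    using bilinear_simps(4)[of x 0 0] bilinear_simps(8)[of 0 0 x] by simp_all
  show 2: "x \<rhd> (- m) = - (x \<rhd> m)" "(- m) \<lhd> x = - (m \<lhd> x)" for x m
    using bilinear_simps(4)[of x "-1" m] bilinear_simps(8)[of "-1" m x] by simp_all
  show "x \<rhd> (m - m') = x \<rhd> m - x \<rhd> m'" "(m - m') \<lhd> x = m \<lhd> x - m' \<lhd> x"
    using bilinear_simps(2)[of x m "- m'"] bilinear_simps(6)[of m "- m'" x] 2 by simp_all
qed

lemma subspace_M0: "M.subspace M0"
  by (simp add: M0_def)

lemma M0_generator: "x \<rhd> m + m \<lhd> x \<in> M0"
  unfolding M0_def by (rule M.span_base) blast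

text \<open>On a generator the right-hand sides of \<open>LML\<close> and \<open>MLL\<close> add up
  to zero.\<close>

lemma M0_ract:
  assumes "m \<in> M0"
  shows "m \<lhd> y = 0"
  using assms unfolding M0_def
proof (induction rule: M.span_induct)
  case base
  show ?case by (auto simp: M.subspace_def)
next
  case (step m)
  then show ?case by (auto simp: LML MLL)
qed

lemma M0_lact:
  assumes "m \<in> M0"
  shows "y \<rhd> m \<in> M0"
  using assms unfolding M0_def
proof (induction rule: M.span_induct)
  case base
  show ?case
    using subspace_M0 unfolding M0_def M.subspace_def by simp
next
  case (step m)
  then obtain x n where m: "m = x \<rhd> n + n \<lhd> x" by blast
  \<comment> \<open>A derivation rule: \<open>y\<close> acts on the algebra entry of the generator
    and then on its module entry, so two generators result.\<close>
  have "y \<rhd> m = ((y \<cdot> x) \<rhd> n + n \<lhd> (y \<cdot> x)) + (x \<rhd> (y \<rhd> n) + (y \<rhd> n) \<lhd> x)"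
    by (simp add: m LLM LML algebra_simps)
  then show ?case
    using M.subspace_add[OF subspace_M0 M0_generator M0_generator] M0_def by auto
qed

lemma subbimodule_M0: "subbimodule M0"
  using subspace_M0 M0_lact M0_ract M.subspace_0 unfolding subbimodule_def by auto

section \<open>Composition factors as covering pairs in the lattice of sub-bimodules\<close>

definition covers :: "'m set \<Rightarrow> 'm set \<Rightarrow> bool" where
  "covers A B \<longleftrightarrow> subbimodule A \<and> subbimodule B \<and> A \<subset> B \<and>
     \<not> (\<exists>P. subbimodule P \<and> A \<subset> P \<and> P \<subset> B)"

text \<open>A proper inclusion that is not a cover splits at some \<open>P\<close>, and both halves
  have a smaller difference of dimensions.\<close>

lemma covers_rtranclp:
  assumes fin: "finite_dimensional_vector_space scaleM Bs"
    and "subbimodule A" "subbimodule B" "A \<subseteq> B"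
  shows "covers\<^sup>*\<^sup>* A B"
  using assms(2-)
proof (induction "M.dim B - M.dim A" arbitrary: A B rule: less_induct)
  case less
  interpret F: finite_dimensional_vector_space scaleM Bs by (rule fin)
  have lt: "M.dim P < M.dim Q" if "subbimodule P" "subbimodule Q" "P \<subset> Q" for P Q
    using F.dim_psubset[of P Q] that M.span_eq_iff unfolding subbimodule_def by metis
  show ?case
  proof (cases "A = B \<or> covers A B")
    case True
    then show ?thesis by auto
  next
    case False
    then obtain P where P: "subbimodule P" "A \<subset> P" "P \<subset> B"
      using less.prems unfolding covers_def by blast
    have "M.dim A < M.dim P" "M.dim P < M.dim B"
      using lt P less.prems by auto
    then have "covers\<^sup>*\<^sup>* A P" "covers\<^sup>*\<^sup>* P B"
      using less.hyps[of P A] less.hyps[of B P] P less.prems by auto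
    then show ?thesis by (rule rtranclp_trans)
  qed
qed

text \<open>Any cover extends to a full composition series by chains of covers from
  \<open>{0}\<close> up to \<open>W\<close> and from \<open>U\<close> up to \<open>UNIV\<close>.
  Hence the hypothesis on composition factors applies to every covering pair.\<close>

lemma covers_imp_composition_factor:
  assumes fin: "finite_dimensional_vector_space scaleM Bs" and cov: "covers W U"
  shows "quotient_vspace scaleM U W \<in> composition_factors"
proof -
  have sub: "subbimodule {0}" "subbimodule UNIV"
    by (auto simp: subbimodule_def M.subspace_def)
  have WU: "subbimodule W" "subbimodule U"
    using cov by (auto simp: covers_def)
  have "{0} \<subseteq> W"
    using WU(1) M.subspace_0 unfolding subbimodule_def by auto
  then have "covers\<^sup>*\<^sup>* {0} W" "covers\<^sup>*\<^sup>* U UNIV"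
    using covers_rtranclp[OF fin] sub WU by auto
  then obtain a b where "(covers ^^ a) {0} W" "(covers ^^ b) U UNIV"
    by (auto simp: rtranclp_power)
  then obtain f g where f: "f 0 = {0}" "f a = W" "\<forall>i<a. covers (f i) (f (Suc i))"
    and g: "g 0 = U" "g b = UNIV" "\<forall>i<b. covers (g i) (g (Suc i))"
    unfolding relpowp_fun_conv by blast
  \<comment> \<open>The two chains are joined by the cover itself: \<open>W\<close> sits at index
    \<open>a\<close> and \<open>U\<close> at \<open>Suc a\<close>, which accounts for the extra step
    in \<open>k\<close>.\<close>
  define N where "N i = (if i \<le> a then f i else g (i - Suc a))" for i
  define k where "k = Suc (a + b)"
  have step: "covers (N i) (N (Suc i))" if "i < k" for i
  proof (cases i a rule: linorder_cases)
    case less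
    then show ?thesis using f by (simp add: N_def)
  next
    case equal
    then show ?thesis using f g cov by (simp add: N_def)
  next
    case greater
    then obtain l where "i = Suc a + l"
      using less_imp_Suc_add[of a i] by auto
    then show ?thesis using g that by (simp add: N_def k_def)
  qed
  have ends: "N 0 = {0}" "N k = UNIV" "N a = W" "N (Suc a) = U"
    using f g by (auto simp: N_def k_def)
  have "subbimodule (N j)" if "j \<le> k" for j
    using step[of j] ends(2) sub that unfolding covers_def by (cases "j = k") auto
  moreover have "covers (N (j - 1)) (N j)" if "j \<in> {1..k}" for j
    using step[of "j - 1"] that by auto
  ultimately have "composition_series k N"
    unfolding composition_series_def using ends by (auto simp: covers_def)
  moreover have "Suc a \<in> {1..k}"
    by (simp add: k_def)
  ultimately show ?thesis
    unfolding composition_factors_def using ends(3,4) by force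
qed

text \<open>Otherwise the span of \<open>W\<close> and \<open>v\<close> would be a sub-bimodule
  covering \<open>W\<close>, because nothing fits strictly inside a quotient of dimension one, and
  this quotient would be a forbidden composition factor.\<close>

lemma bimodule_weight_free:
  assumes fin: "finite_dimensional_vector_space scaleM Bs"
    and nofac: "\<forall>Q\<in>composition_factors. \<not> has_dim Q 1"
    and W: "subbimodule W"
    and l: "\<And>x. x \<rhd> v - scaleM (\<mu> x) v \<in> W" and r: "\<And>x. v \<lhd> x - scaleM (\<nu> x) v \<in> W"
  shows "v \<in> W"
proof (rule ccontr)
  assume v: "v \<notin> W"
  define U where "U = {w + scaleM c v | w c. w \<in> W}"
  have Ws: "M.subspace W" and Wl: "\<And>x w. w \<in> W \<Longrightarrow> x \<rhd> w \<in> W"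
    and Wr: "\<And>x w. w \<in> W \<Longrightarrow> w \<lhd> x \<in> W"
    using W by (auto simp: subbimodule_def)
  have UI: "w + scaleM c v \<in> U" if "w \<in> W" for w c
    using that by (auto simp: U_def)
  have Us: "M.subspace U"
  proof (rule M.subspaceI)
    show "0 \<in> U"
      using UI[of 0 0] M.subspace_0[OF Ws] by simp
  next
    fix x y assume "x \<in> U" "y \<in> U"
    then obtain w c w' c' where "x = w + scaleM c v" "w \<in> W" "y = w' + scaleM c' v" "w' \<in> W"
      unfolding U_def by blast
    then show "x + y \<in> U"
      using UI[of "w + w'" "c + c'"] M.subspace_add[OF Ws] by (simp add: M.scale_left_distrib algebra_simps)
  next
    fix x a assume "x \<in> U"
    then obtain w c where "x = w + scaleM c v" "w \<in> W"
      unfolding U_def by blast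
    then show "scaleM a x \<in> U"
      using UI[of "scaleM a w" "a * c"] M.subspace_scale[OF Ws] by (simp add: M.scale_right_distrib)
  qed
  have "x \<rhd> u \<in> U \<and> u \<lhd> x \<in> U" if uU: "u \<in> U" for x u
  proof -
    obtain w c where u: "u = w + scaleM c v" "w \<in> W"
      using uU unfolding U_def by blast
    have "x \<rhd> u = (x \<rhd> w + scaleM c (x \<rhd> v - scaleM (\<mu> x) v)) + scaleM (c * \<mu> x) v"
      "u \<lhd> x = (w \<lhd> x + scaleM c (v \<lhd> x - scaleM (\<nu> x) v)) + scaleM (c * \<nu> x) v"
      by (auto simp: u M.scale_right_diff_distrib)
    then show ?thesis
      using UI M.subspace_add[OF Ws] M.subspace_scale[OF Ws] Wl Wr l r u(2) by metis
  qed
  with Us have U: "subbimodule U"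
    by (auto simp: subbimodule_def)
  have WU: "W \<subseteq> U" using UI[of _ 0] by auto
  have "v \<in> U" using UI[of 0 1] M.subspace_0[OF Ws] by simp
  have "covers W U"
    unfolding covers_def
  proof (intro conjI notI)
    show "W \<subset> U" using WU v \<open>v \<in> U\<close> by auto
    assume "\<exists>P. subbimodule P \<and> W \<subset> P \<and> P \<subset> U"
    then obtain P where P: "subbimodule P" "W \<subset> P" "P \<subset> U" by blast
    have Ps: "M.subspace P" using P(1) by (simp add: subbimodule_def)
    obtain p where p: "p \<in> P" "p \<notin> W" using P by blast
    obtain w c where wc: "p = w + scaleM c v" "w \<in> W"
      using p(1) P(3) unfolding U_def by blast
    \<comment> \<open>An element of \<open>P\<close> outside \<open>W\<close> involves
      \<open>v\<close> with an invertible coefficient, so \<open>P\<close> contains \<open>v\<close>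
      and is all of \<open>U\<close>.\<close>
    with p(2) have "c \<noteq> 0" by auto
    have "scaleM c v \<in> P"
      using M.subspace_diff[OF Ps p(1), of w] wc P(2) by auto
    from M.subspace_scale[OF Ps this, of "inverse c"] \<open>c \<noteq> 0\<close> have "v \<in> P" by simp
    then have "U \<subseteq> P"
      using M.subspace_add[OF Ps] M.subspace_scale[OF Ps] P(2) unfolding U_def by blast
    with P(3) show False by blast
  qed (use W U in auto)
  from covers_imp_composition_factor[OF fin this] nofac show False
    using M.has_dim_quotient_oneI[OF Ws v] U_def by blast
qed

text \<open>
  Modulo \<open>M0\<close> the right action is minus the left one, and on \<open>M0\<close> it is zero; so left
  submodules are sub-bimodules on either layer.
\<close>

lemma weight_free_lact:
  assumes fin: "finite_dimensional_vector_space scaleM Bs"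
    and nofac: "\<forall>Q\<in>composition_factors. \<not> has_dim Q 1"
  shows "weight_free scaleM (\<rhd>) UNIV"
  unfolding weight_free_def
proof (intro allI impI)
  fix W \<mu> v
  assume Ws: "M.subspace W" and Wl: "\<forall>x. \<forall>w\<in>W. x \<rhd> w \<in> W"
    and v: "\<forall>x. x \<rhd> v - scaleM (\<mu> x) v \<in> W"
  \<comment> \<open>The vector is first pushed into \<open>S\<close>; its
    \<open>M0\<close>-component is then tested modulo the intersection of \<open>W\<close> with
    \<open>M0\<close>.\<close>
  define S where "S = {w + m | w m. w \<in> W \<and> m \<in> M0}"
  have Ss: "M.subspace S"
    unfolding S_def using M.subspace_sums[OF Ws subspace_M0] by simp
  have WS: "W \<subseteq> S" and MS: "M0 \<subseteq> S"
    unfolding S_def using M.subspace_0[OF Ws] M.subspace_0[OF subspace_M0] by force+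
  have Sl: "x \<rhd> s \<in> S" if "s \<in> S" for x s
    using that Wl M0_lact unfolding S_def by fastforce
  have flip: "s \<lhd> x + x \<rhd> s \<in> S" for x s
    using M0_generator[of x s] MS by (auto simp: add.commute)
  have "s \<lhd> x \<in> S" if "s \<in> S" for x s
    using M.subspace_diff[OF Ss flip[of s x] Sl[OF that, of x]] by simp
  with Ss Sl have "subbimodule S"
    by (auto simp: subbimodule_def)
  moreover have vS: "x \<rhd> v - scaleM (\<mu> x) v \<in> S" for x
    using v WS by auto
  \<comment> \<open>By \<open>flip\<close>, the right weight modulo \<open>S\<close> is the negative
    of the left weight.\<close>
  moreover have "v \<lhd> x - scaleM (- \<mu> x) v \<in> S" for x
    using M.subspace_diff[OF Ss flip[of v x] vS[of x]] by simp
  ultimately have "v \<in> S"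
    by (rule bimodule_weight_free[OF fin nofac])
  then obtain w m where wm: "v = w + m" "w \<in> W" "m \<in> M0"
    unfolding S_def by blast
  have "m \<in> W \<inter> M0"
  proof (rule bimodule_weight_free[OF fin nofac])
    show "subbimodule (W \<inter> M0)"
      unfolding subbimodule_def
      using M.subspace_inter[OF Ws subspace_M0] Wl M0_lact M0_ract M.subspace_0[OF Ws]
        M.subspace_0[OF subspace_M0] by auto
    fix x
    show "m \<lhd> x - scaleM 0 m \<in> W \<inter> M0"
      using M0_ract[OF wm(3)] M.subspace_0[OF Ws] M.subspace_0[OF subspace_M0] by auto
    have "x \<rhd> m - scaleM (\<mu> x) m = (x \<rhd> v - scaleM (\<mu> x) v) - (x \<rhd> w - scaleM (\<mu> x) w)"
      by (simp add: wm(1) M.scale_right_distrib)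
    moreover have "x \<rhd> w - scaleM (\<mu> x) w \<in> W"
      using M.subspace_diff[OF Ws] Wl M.subspace_scale[OF Ws] wm(2) by auto
    ultimately have "x \<rhd> m - scaleM (\<mu> x) m \<in> W"
      using M.subspace_diff[OF Ws] v by simp
    moreover have "x \<rhd> m - scaleM (\<mu> x) m \<in> M0"
      using M.subspace_diff[OF subspace_M0] M0_lact M.subspace_scale[OF subspace_M0] wm(3) by blast
    ultimately show "x \<rhd> m - scaleM (\<mu> x) m \<in> W \<inter> M0" ..
  qed
  then show "v \<in> W"
    using wm M.subspace_add[OF Ws] by auto
qed

section \<open>The algebra action on cochains\<close>

text \<open>The contraction \<open>i y\<close> of Cartan's formula.\<close>

definition insert_arg :: "'l \<Rightarrow> ('l list \<Rightarrow> 'm) \<Rightarrow> 'l list \<Rightarrow> 'm" where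
  "insert_arg y f = (\<lambda>ys. f (y # ys))"

text \<open>The Lie derivative. Its sum runs over the length of the list, so that one operator
  serves all degrees.\<close>

definition \<theta> :: "'l \<Rightarrow> ('l list \<Rightarrow> 'm) \<Rightarrow> 'l list \<Rightarrow> 'm" where
  "\<theta> x f = (\<lambda>xs. x \<rhd> f xs - (\<Sum>j<length xs. f (xs[j := x \<cdot> (xs ! j)])))"

interpretation C: vector_space scaleCL
  by standard (auto simp: scaleCL_def fun_eq_iff M.scale_right_distrib M.scale_left_distrib)

lemma scaleCL_apply [simp]: "scaleCL c f xs = scaleM c (f xs)"
  by (simp add: scaleCL_def)

lemma insert_arg_linear [simp]:
  "insert_arg y (f + g) = insert_arg y f + insert_arg y g"
  "insert_arg y (f - g) = insert_arg y f - insert_arg y g"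
  "insert_arg y (scaleCL c f) = scaleCL c (insert_arg y f)"
  "insert_arg y 0 = 0"
  by (auto simp: insert_arg_def)

lemma \<theta>_linear:
  "\<theta> x (f + g) = \<theta> x f + \<theta> x g"
  "\<theta> x (f - g) = \<theta> x f - \<theta> x g"
  "\<theta> x (scaleCL c f) = scaleCL c (\<theta> x f)"
  "\<theta> x 0 = 0"
  by (auto simp: \<theta>_def scaleCL_def fun_eq_iff sum.distrib sum_subtractf
      M.scale_right_diff_distrib M.scale_sum_right)

lemma \<theta>_Nil [simp]: "\<theta> x f [] = x \<rhd> f []"
  by (simp add: \<theta>_def)

lemma \<theta>_Cons: "\<theta> x f (y # ys) = \<theta> x (insert_arg y f) ys - f ((x \<cdot> y) # ys)"
  by (simp add: \<theta>_def insert_arg_def sum.lessThan_Suc_shift del: sum.lessThan_Suc)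

text \<open>Cartan's rule for the commutator of Lie derivative and contraction: the correction is
  the summand at the slot filled by \<open>y\<close>. Inductions on the degree rest on it.\<close>

lemma insert_arg_\<theta>: "insert_arg y (\<theta> x f) = \<theta> x (insert_arg y f) - insert_arg (x \<cdot> y) f"
  by (rule ext) (simp add: \<theta>_Cons insert_arg_def[of y "\<theta> x f"] insert_arg_def[of "x \<cdot> y"])

lemma CL_0_iff: "f \<in> CL 0 \<longleftrightarrow> (\<forall>xs. xs \<noteq> [] \<longrightarrow> f xs = 0)"
  by (auto simp: CL_def)

text \<open>Currying: cochains of degree \<open>Suc n\<close> are linear maps from the algebra to
  those of degree \<open>n\<close>. The value at \<open>[]\<close> is listed separately because no
  contraction sees it.\<close>

lemma CL_Suc_iff:
  "f \<in> CL (Suc n) \<longleftrightarrow> f [] = 0 \<and> (\<forall>y. insert_arg y f \<in> CL n) \<and>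
     (\<forall>y z. insert_arg (y + z) f = insert_arg y f + insert_arg z f) \<and>
     (\<forall>c y. insert_arg (scaleL c y) f = scaleCL c (insert_arg y f))" (is "_ \<longleftrightarrow> ?R")
proof
  assume f: "f \<in> CL (Suc n)"
  have zero: "f xs = 0" if "length xs \<noteq> Suc n" for xs
    using f that by (auto simp: CL_def)
  have lin: "Vector_Spaces.linear scaleL scaleM (\<lambda>x. f (xs[i := x]))"
    if "length xs = Suc n" "i < Suc n" for xs i
    using f that by (auto simp: CL_def)
  have "Vector_Spaces.linear scaleL scaleM (\<lambda>x. f (x # ys))" for ys
  proof (cases "length ys = n")
    case True
    \<comment> \<open>The dummy head is overwritten by the update at position 0.\<close>
    then show ?thesis using lin[of "undefined # ys" 0] by simp
  next
    case False
    then show ?thesis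
      by (simp add: zero Vector_Spaces.linear_iff L.vector_space_axioms M.vector_space_axioms)
  qed
  moreover have "insert_arg y f \<in> CL n" for y
    using zero lin[of "y # _" "Suc _"] by (auto simp: CL_def insert_arg_def)
  ultimately show ?R
    using zero[of "[]"] by (auto simp: insert_arg_def scaleCL_def fun_eq_iff Vector_Spaces.linear_iff)
next
  assume R: ?R
  have "f xs = 0" if "length xs \<noteq> Suc n" for xs
    using R that by (cases xs) (auto simp: CL_def insert_arg_def)
  moreover have "Vector_Spaces.linear scaleL scaleM (\<lambda>x. f (xs[i := x]))"
    if "length xs = Suc n" "i < Suc n" for xs i
  proof -
    from that(1) obtain y ys where xs: "xs = y # ys" "length ys = n"
      by (auto simp: length_Suc_conv)
    show ?thesis
    proof (cases i)
      case 0
      then show ?thesis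
        using R by (simp add: xs insert_arg_def scaleCL_def fun_eq_iff Vector_Spaces.linear_iff
            L.vector_space_axioms M.vector_space_axioms)
    next
      case (Suc i')
      have "insert_arg y f \<in> CL n" using R by blast
      then show ?thesis
        using xs Suc that(2) by (auto simp: CL_def insert_arg_def)
    qed
  qed
  ultimately show "f \<in> CL (Suc n)"
    by (auto simp: CL_def)
qed

lemma CL_Suc_additive:
  "f \<in> CL (Suc n) \<Longrightarrow> insert_arg (y + z) f = insert_arg y f + insert_arg z f"
  unfolding CL_Suc_iff by blast

lemma CL_Suc_homogeneous:
  "f \<in> CL (Suc n) \<Longrightarrow> insert_arg (scaleL c y) f = scaleCL c (insert_arg y f)"
  unfolding CL_Suc_iff by blast

lemma subspace_CL: "C.subspace (CL n)"
proof (induction n)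
  case 0
  show ?case
    by (rule C.subspaceI) (simp_all add: CL_0_iff)
next
  case (Suc n)
  show ?case
  proof (rule C.subspaceI)
    show "0 \<in> CL (Suc n)"
      using C.subspace_0[OF Suc] by (simp add: CL_Suc_iff)
  next
    fix f g assume "f \<in> CL (Suc n)" "g \<in> CL (Suc n)"
    then show "f + g \<in> CL (Suc n)"
      using C.subspace_add[OF Suc] by (simp add: CL_Suc_iff C.scale_right_distrib)
  next
    fix c f assume "f \<in> CL (Suc n)"
    then show "scaleCL c f \<in> CL (Suc n)"
      using C.subspace_scale[OF Suc]
      by (simp add: CL_Suc_iff C.scale_right_distrib mult.commute)
  qed
qed

lemma \<theta>_in_CL:
  assumes "f \<in> CL n"
  shows "\<theta> x f \<in> CL n"
  using assms
proof (induction n arbitrary: f)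
  case 0
  then show ?case
    by (simp add: CL_0_iff \<theta>_def)
next
  case (Suc n)
  then show ?case
    by (auto simp: CL_Suc_iff insert_arg_\<theta> \<theta>_linear C.scale_right_diff_distrib
        intro: C.subspace_diff[OF subspace_CL])
qed

text \<open>For the values of \<open>f\<close> this is \<open>LLM\<close>, for each argument slot
  the left Leibniz identity; slots are peeled off one at a time.\<close>

lemma \<theta>_commutator:
  assumes "f \<in> CL n"
  shows "\<theta> x (\<theta> y f) - \<theta> y (\<theta> x f) = \<theta> (x \<cdot> y) f"
proof -
  have "\<theta> x (\<theta> y f) xs - \<theta> y (\<theta> x f) xs = \<theta> (x \<cdot> y) f xs" for xs
    using assms
  proof (induction xs arbitrary: f n)
    case Nil
    show ?case by (simp add: LLM)
  next
    case (Cons z zs)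
    show ?case
    proof (cases n)
      case 0
      have "\<theta> a g xs = 0" if "g \<in> CL 0" "xs \<noteq> []" for a g xs
        using \<theta>_in_CL[OF that(1), of a] that(2) by (simp add: CL_0_iff)
      then show ?thesis
        using Cons.prems \<theta>_in_CL 0 by auto
    next
      case (Suc m)
      have f: "insert_arg z f \<in> CL m"
        "insert_arg (x \<cdot> (y \<cdot> z)) f = insert_arg ((x \<cdot> y) \<cdot> z) f + insert_arg (y \<cdot> (x \<cdot> z)) f"
        using Cons.prems unfolding Suc CL_Suc_iff left_leibniz[of x y z] by auto
      \<comment> \<open>The mixed terms, with one Lie derivative outside a contraction, are
        symmetric in \<open>x\<close> and \<open>y\<close> and cancel; \<open>f(2)\<close> combines
        the rest.\<close>
      have "insert_arg z (\<theta> x (\<theta> y f)) - insert_arg z (\<theta> y (\<theta> x f)) =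
          (\<theta> x (\<theta> y (insert_arg z f)) - \<theta> y (\<theta> x (insert_arg z f))) - insert_arg ((x \<cdot> y) \<cdot> z) f"
        by (simp add: insert_arg_\<theta> \<theta>_linear f(2))
      from fun_cong[OF this, of zs] Cons.IH[OF f(1)]
      have "\<theta> x (\<theta> y f) (z # zs) - \<theta> y (\<theta> x f) (z # zs)
          = (\<theta> (x \<cdot> y) (insert_arg z f) - insert_arg ((x \<cdot> y) \<cdot> z) f) zs"
        by (simp add: insert_arg_def)
      then show ?thesis
        by (simp add: \<theta>_Cons insert_arg_def)
    qed
  qed
  then show ?thesis by (auto simp: fun_eq_iff)
qed

section \<open>The differential and Cartan's formula\<close>

lemma d_0: "d 0 f xs = (if length xs = 1 then - (f [] \<lhd> (xs ! 0)) else 0)"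
  by (simp add: d_def)

text \<open>Cartan's homotopy formula for \<open>\<theta>\<close>. It fails in degree \<open>0\<close> unless the bimodule is symmetric.\<close>

lemma d_Suc_Cons:
  "d (Suc n) f (x # xs) = (if length xs = Suc n then \<theta> x f xs - d n (insert_arg x f) xs else 0)"
proof (cases "length xs = Suc n")
  case True
  have omit: "omit 0 (a # ys) = ys" "omit (Suc i) (a # ys) = a # omit i ys" for a i and ys :: "'l list"
    by (simp_all add: omit_def)
  have \<theta>: "\<theta> x f xs = x \<rhd> f xs - (\<Sum>j\<le>n. f (xs[j := x \<cdot> (xs ! j)]))"
    by (simp add: \<theta>_def True lessThan_Suc_atMost)
  \<comment> \<open>The term \<open>j = 0\<close> of the first sum and the terms
    \<open>i = 0\<close> of the double sum form \<open>\<theta> x f\<close>. In all others the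
    indices drop by one, which reverses the sign and leaves
    \<open>- d n (insert_arg x f)\<close>.\<close>
  show ?thesis
    using True
    by (simp add: d_def \<theta> insert_arg_def omit sum.atMost_Suc_shift sum.lessThan_Suc_shift
        sum_negf sum.distrib sum_subtractf del: sum.lessThan_Suc sum.atMost_Suc)
qed (simp add: d_def)

text \<open>On lists of the wrong length both differentials vanish by definition, and
  \<open>\<theta> x f\<close> because it is again a cochain.\<close>

lemma insert_arg_d:
  assumes "f \<in> CL (Suc n)"
  shows "insert_arg x (d (Suc n) f) = \<theta> x f - d n (insert_arg x f)"
proof
  fix xs
  have "\<theta> x f \<in> CL (Suc n)"
    by (rule \<theta>_in_CL[OF assms])
  then have "\<theta> x f xs = 0" if "length xs \<noteq> Suc n"
    using that by (simp add: CL_def)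
  moreover have "d n (insert_arg x f) xs = 0" if "length xs \<noteq> Suc n"
    using that by (simp add: d_def)
  ultimately show "insert_arg x (d (Suc n) f) xs = (\<theta> x f - d n (insert_arg x f)) xs"
    by (auto simp: insert_arg_def[of x "d (Suc n) f"] d_Suc_Cons)
qed

lemma d_linear: "d n (f + g) = d n f + d n g" "d n (scaleCL c f) = scaleCL c (d n f)"
proof -
  have "d n (f + g) xs = d n f xs + d n g xs \<and> d n (scaleCL c f) xs = scaleM c (d n f xs)" for xs
  proof (induction n arbitrary: f g xs)
    case 0
    show ?case by (simp add: d_0)
  next
    case (Suc n)
    show ?case
    proof (cases xs)
      case Nil
      then show ?thesis by (simp add: d_def)
    next
      case (Cons y ys)
      then show ?thesis
        unfolding Cons d_Suc_Cons insert_arg_linear \<theta>_linear conjunct1[OF Suc] conjunct2[OF Suc]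
        by (simp add: M.scale_right_diff_distrib)
    qed
  qed
  then show "d n (f + g) = d n f + d n g" "d n (scaleCL c f) = scaleCL c (d n f)"
    by (auto simp: fun_eq_iff)
qed

lemma d_zero_diff: "d n 0 = 0" "d n (f - g) = d n f - d n g"
proof -
  show "d n 0 = 0"
    using d_linear(1)[of n 0 0] by simp
  show "d n (f - g) = d n f - d n g"
    using d_linear(1)[of n "f - g" g] by (simp add: algebra_simps)
qed

text \<open>Degree 0 is \<open>LML\<close>. Higher up, both sides are compared after contraction
  with \<open>y\<close>: Cartan's formula reduces them to the commutator of
  \<open>\<theta> x\<close> with \<open>\<theta> y\<close> and to the claim one degree
  lower.\<close>

lemma \<theta>_d:
  assumes "f \<in> CL n"
  shows "\<theta> x (d n f) = d n (\<theta> x f)"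
  using assms
proof (induction n arbitrary: f)
  case 0
  show ?case
  proof
    fix xs
    show "\<theta> x (d 0 f) xs = d 0 (\<theta> x f) xs"
    proof (cases "length xs = 1")
      case True
      then obtain y where "xs = [y]" by (auto simp: length_Suc_conv)
      then show ?thesis by (simp add: \<theta>_def d_0 LML)
    qed (simp add: \<theta>_def d_0)
  qed
next
  case (Suc n)
  show ?case
  proof
    fix xs
    show "\<theta> x (d (Suc n) f) xs = d (Suc n) (\<theta> x f) xs"
    proof (cases xs)
      case Nil
      then show ?thesis by (simp add: d_def)
    next
      case (Cons y ys)
      have "insert_arg y f \<in> CL n"
        using Suc.prems by (simp add: CL_Suc_iff)
      then have "insert_arg y (\<theta> x (d (Suc n) f)) = insert_arg y (d (Suc n) (\<theta> x f))"
        using \<theta>_commutator[OF Suc.prems, of x y, symmetric] Suc.IH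
        by (simp add: insert_arg_\<theta> insert_arg_d Suc.prems \<theta>_in_CL \<theta>_linear d_zero_diff)
      from fun_cong[OF this, of ys] show ?thesis
        by (simp add: Cons insert_arg_def)
    qed
  qed
qed

section \<open>Cochains have no one-dimensional subquotients\<close>

lemma weight_free_CL_0:
  assumes "weight_free scaleM (\<rhd>) UNIV"
  shows "weight_free scaleCL \<theta> (CL 0)"
  unfolding weight_free_def
proof (intro allI impI)
  fix W \<mu> f
  assume W: "C.subspace W" "\<forall>x. \<forall>w\<in>W. \<theta> x w \<in> W" and f: "f \<in> CL 0"
    and \<mu>: "\<forall>x. \<theta> x f - scaleCL (\<mu> x) f \<in> W"
  \<comment> \<open>Evaluation at \<open>[]\<close> identifies \<open>CL 0\<close> with
    \<open>M\<close>. As \<open>W\<close> may contain other functions, it is cut down to where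
    evaluation is injective.\<close>
  let ?W = "(\<lambda>g. g []) ` (W \<inter> CL 0)"
  have WC: "C.subspace (W \<inter> CL 0)"
    by (rule C.subspace_inter[OF W(1) subspace_CL])
  have "f [] \<in> ?W"
  proof (rule M.weight_freeD[OF assms])
    show "M.subspace ?W"
    proof (rule M.subspaceI)
      show "0 \<in> ?W"
        using C.subspace_0[OF WC] by (auto intro: image_eqI[where x = 0])
    next
      fix a b assume "a \<in> ?W" "b \<in> ?W"
      then obtain g h where "g \<in> W \<inter> CL 0" "h \<in> W \<inter> CL 0" "a = g []" "b = h []" by blast
      then show "a + b \<in> ?W"
        using C.subspace_add[OF WC, of g h] by (intro image_eqI[where x = "g + h"]) auto
    next
      fix c a assume "a \<in> ?W"
      then obtain g where "g \<in> W \<inter> CL 0" "a = g []" by blast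
      then show "scaleM c a \<in> ?W"
        using C.subspace_scale[OF WC, of g c] by (intro image_eqI[where x = "scaleCL c g"]) auto
    qed
    show "x \<rhd> w \<in> ?W" if w: "w \<in> ?W" for x w
    proof -
      obtain g where "g \<in> W \<inter> CL 0" "w = g []" using w by blast
      then show ?thesis
        using W(2) \<theta>_in_CL by (intro image_eqI[where x = "\<theta> x g"]) auto
    qed
    show "x \<rhd> f [] - scaleM (\<mu> x) (f []) \<in> ?W" for x
      using \<mu> C.subspace_diff[OF subspace_CL \<theta>_in_CL[OF f] C.subspace_scale[OF subspace_CL f]]
      by (intro image_eqI[where x = "\<theta> x f - scaleCL (\<mu> x) f"]) auto
  qed simp
  then obtain g where g: "g \<in> W" "g \<in> CL 0" "f [] = g []" by blast
  with f have "f = g"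
    unfolding CL_0_iff fun_eq_iff by metis
  with g show "f \<in> W" by simp
qed

lemma weight_free_CL_Suc:
  assumes super: supersolvable and wf: "weight_free scaleCL \<theta> (CL n)"
  shows "weight_free scaleCL \<theta> (CL (Suc n))"
  unfolding weight_free_def
proof (intro allI impI)
  fix W \<mu> f
  assume W: "C.subspace W" "\<forall>x. \<forall>w\<in>W. \<theta> x w \<in> W" and f: "f \<in> CL (Suc n)"
    and \<mu>: "\<forall>x. \<theta> x f - scaleCL (\<mu> x) f \<in> W"
  obtain k I where "one_dim_flag k I"
    using super supersolvable_iff by blast
  then have I: "I k = UNIV" "I 0 = {0}" "\<And>j. j \<le> k \<Longrightarrow> ideal (I j)"
    "\<And>j. j \<in> {1..k} \<Longrightarrow> has_dim (quotient_vspace scaleL (I j) (I (j - 1))) 1"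
    unfolding one_dim_flag_def by simp_all
  \<comment> \<open>A descending filtration by \<theta>-stable subspaces, equal to
    \<open>CL (Suc n)\<close> at \<open>j = 0\<close> and to zero at \<open>j = k\<close>.
    Subtracting elements of \<open>W\<close> moves \<open>f\<close> down layer by layer.\<close>
  define H where "H j = {g \<in> CL (Suc n). \<forall>a\<in>I j. insert_arg a g = 0}" for j
  have subH: "C.subspace (H j)" for j
    by (rule C.subspaceI)
      (simp_all add: H_def C.subspace_0 C.subspace_add C.subspace_scale subspace_CL)
  have \<theta>H: "\<theta> x g \<in> H j" if "g \<in> H j" "j \<le> k" for x g j
    using that I(3)[of j] \<theta>_in_CL[of g "Suc n" x]
    by (auto simp: H_def insert_arg_\<theta> \<theta>_linear ideal_def)
  have "\<exists>w\<in>W. f - w \<in> H j" if "j \<le> k" for j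
    using that
  proof (induction j)
    case 0
    have "insert_arg 0 f = 0"
      using f C.scale_zero_left L.scale_zero_left unfolding CL_Suc_iff by metis
    then have "f - 0 \<in> H 0"
      using f by (simp add: H_def I(2))
    then show ?case
      using C.subspace_0[OF W(1)] by blast
  next
    case (Suc j)
    then obtain w where w: "w \<in> W" "f - w \<in> H j"
      using Suc_leD by blast
    define g where "g = f - w"
    have gH: "g \<in> H j" using w(2) by (simp add: g_def)
    have idl: "L.subspace (I j)" "L.subspace (I (Suc j))" "\<And>x a. a \<in> I (Suc j) \<Longrightarrow> x \<cdot> a \<in> I (Suc j)"
      using I(3)[of j] I(3)[of "Suc j"] Suc.prems by (auto simp: ideal_def)
    obtain e where e: "e \<in> I (Suc j)" "\<And>u. u \<in> I (Suc j) \<Longrightarrow> \<exists>c. u - scaleL c e \<in> I j"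
      using L.has_dim_quotient_oneE[OF idl(1,2)] I(4)[of "Suc j"] Suc.prems by auto
    \<comment> \<open>Left multiplication acts on the line spanned by \<open>e\<close> in the layer
      of ideals by scalars; these form the twisting character \<open>\<nu>\<close>.\<close>
    have "\<forall>x. \<exists>c. x \<cdot> e - scaleL c e \<in> I j"
      using e(2)[OF idl(3)[OF e(1)]] by blast
    from choice[OF this] obtain \<nu> where \<nu>: "\<And>x. x \<cdot> e - scaleL (\<nu> x) e \<in> I j"
      by blast
    have split: "insert_arg u h = scaleCL c (insert_arg e h)"
      if "h \<in> H j" "u - scaleL c e \<in> I j" for h u c
    proof -
      have h: "h \<in> CL (Suc n)" "insert_arg (u - scaleL c e) h = 0"
        using that by (simp_all add: H_def)
      have "insert_arg u h = insert_arg (u - scaleL c e) h + insert_arg (scaleL c e) h"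
        using CL_Suc_additive[OF h(1), of "u - scaleL c e" "scaleL c e"] by simp
      then show ?thesis
        using CL_Suc_homogeneous[OF h(1)] h(2) by simp
    qed
    \<comment> \<open>Contraction with \<open>e\<close> embeds the layer
      \<open>H j / H (Suc j)\<close> into \<open>CL n\<close> and intertwines the actions up to
      \<open>\<nu>\<close>.\<close>
    have twist: "insert_arg e (\<theta> x h) = \<theta> x (insert_arg e h) - scaleCL (\<nu> x) (insert_arg e h)"
      if "h \<in> H j" for x h
      using split[OF that \<nu>] by (simp add: insert_arg_\<theta>)
    let ?W = "insert_arg e ` (W \<inter> H j)"
    have WH: "C.subspace (W \<inter> H j)"
      by (rule C.subspace_inter[OF W(1) subH])
    have subW: "C.subspace ?W"
    proof (rule C.subspaceI)
      show "0 \<in> ?W"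
        using C.subspace_0[OF WH] by (auto intro: image_eqI[where x = 0])
    next
      fix a b assume "a \<in> ?W" "b \<in> ?W"
      then obtain a' b' where "a' \<in> W \<inter> H j" "b' \<in> W \<inter> H j" "a = insert_arg e a'" "b = insert_arg e b'"
        by blast
      then show "a + b \<in> ?W"
        using C.subspace_add[OF WH, of a' b'] by (intro image_eqI[where x = "a' + b'"]) auto
    next
      fix c a assume "a \<in> ?W"
      then obtain a' where "a' \<in> W \<inter> H j" "a = insert_arg e a'" by blast
      then show "scaleCL c a \<in> ?W"
        using C.subspace_scale[OF WH, of a' c] by (intro image_eqI[where x = "scaleCL c a'"]) auto
    qed
    have "insert_arg e g \<in> ?W"
    proof (rule C.weight_freeD[OF wf subW])
      show "\<theta> x b \<in> ?W" if b: "b \<in> ?W" for x b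
      proof -
        obtain h where h: "h \<in> W" "h \<in> H j" "b = insert_arg e h" using b by blast
        \<comment> \<open>The added multiple of \<open>h\<close> compensates the twist, giving a
          preimage of \<open>\<theta> x b\<close>.\<close>
        have "\<theta> x h + scaleCL (\<nu> x) h \<in> W \<inter> H j"
          using C.subspace_add[OF W(1)] C.subspace_add[OF subH] C.subspace_scale[OF W(1)]
            C.subspace_scale[OF subH] h W(2) \<theta>H Suc.prems by auto
        then show ?thesis
          by (rule image_eqI[rotated]) (simp add: h(3) twist[OF h(2)])
      qed
      show "insert_arg e g \<in> CL n"
        using gH by (simp add: H_def CL_Suc_iff)
      show "\<theta> x (insert_arg e g) - scaleCL (\<mu> x + \<nu> x) (insert_arg e g) \<in> ?W" for x
      proof (rule image_eqI)
        let ?h = "\<theta> x g - scaleCL (\<mu> x) g"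
        show "\<theta> x (insert_arg e g) - scaleCL (\<mu> x + \<nu> x) (insert_arg e g) = insert_arg e ?h"
          by (simp add: twist[OF gH] C.scale_left_distrib)
        have "?h = (\<theta> x f - scaleCL (\<mu> x) f) - (\<theta> x w - scaleCL (\<mu> x) w)"
          by (simp add: g_def \<theta>_linear C.scale_right_diff_distrib)
        moreover have "\<theta> x w - scaleCL (\<mu> x) w \<in> W"
          using C.subspace_diff[OF W(1)] C.subspace_scale[OF W(1)] W(2) w(1) by auto
        ultimately have "?h \<in> W"
          using C.subspace_diff[OF W(1)] \<mu> by auto
        moreover have "?h \<in> H j"
          using C.subspace_diff[OF subH] C.subspace_scale[OF subH] \<theta>H[OF gH] gH Suc.prems by auto
        ultimately show "?h \<in> W \<inter> H j" by blast
      qed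
    qed
    then obtain h where h: "h \<in> W" "h \<in> H j" "insert_arg e g = insert_arg e h" by blast
    have gh: "g - h \<in> H j"
      by (rule C.subspace_diff[OF subH gH h(2)])
    \<comment> \<open>On \<open>I (Suc j)\<close>, an element of \<open>H j\<close> is determined by
      its contraction with \<open>e\<close>, where \<open>g\<close> and \<open>h\<close>
      agree.\<close>
    have "insert_arg u (g - h) = 0" if u: "u \<in> I (Suc j)" for u
    proof -
      obtain c where "u - scaleL c e \<in> I j" using e(2)[OF u] by blast
      from split[OF gh this] h(3) show ?thesis by simp
    qed
    with gh have "g - h \<in> H (Suc j)"
      by (simp add: H_def)
    then have "f - (w + h) \<in> H (Suc j)"
      by (simp add: g_def diff_diff_eq)
    then show ?case
      using C.subspace_add[OF W(1) w(1) h(1)] by blast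
  qed
  then obtain w where w: "w \<in> W" "f - w \<in> H k" by blast
  have "(f - w) xs = 0" for xs
  proof (cases xs)
    case Nil
    then show ?thesis using w(2) by (simp add: H_def CL_Suc_iff)
  next
    case (Cons y ys)
    have "insert_arg y (f - w) = 0"
      using w(2) I(1) by (simp add: H_def)
    from fun_cong[OF this, of ys] show ?thesis
      by (simp add: Cons insert_arg_def)
  qed
  then have "f = w" by (simp add: fun_eq_iff)
  with w(1) show "f \<in> W" by simp
qed

section \<open>Cohomology in positive degrees and in degree zero\<close>

lemma subspace_coboundaries: "C.subspace (coboundaries n)"
proof (cases n)
  case 0
  then show ?thesis by (simp add: coboundaries_def)
next
  case (Suc m)
  have S: "C.subspace (CL m)" by (rule subspace_CL)
  show ?thesis
    unfolding Suc coboundaries_def C.subspace_def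
    using C.subspace_0[OF S] C.subspace_add[OF S] C.subspace_scale[OF S]
    by (auto simp: d_linear[symmetric] image_iff) (metis d_zero_diff(1))
qed

text \<open>For a cocycle Cartan's formula leaves
  \<open>\<theta> x f = d n (insert_arg x f)\<close>, so \<open>f\<close> has weight zero modulo the
  coboundaries, a \<theta>-stable subspace by \<open>\<theta>_d\<close>.\<close>

lemma cocycle_is_coboundary:
  assumes wf: "weight_free scaleCL \<theta> (CL (Suc n))" and f: "f \<in> cocycles (Suc n)"
  shows "f \<in> coboundaries (Suc n)"
proof (rule C.weight_freeD[OF wf subspace_coboundaries])
  show fC: "f \<in> CL (Suc n)"
    using f by (simp add: cocycles_def)
  show "\<theta> x w \<in> coboundaries (Suc n)" if "w \<in> coboundaries (Suc n)" for x w
    using that \<theta>_d \<theta>_in_CL by (auto simp: coboundaries_def)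
  fix x
  have "\<theta> x f = d n (insert_arg x f)"
    using insert_arg_d[OF fC, of x] f by (simp add: cocycles_def)
  moreover have "insert_arg x f \<in> CL n"
    using fC by (simp add: CL_Suc_iff)
  ultimately show "\<theta> x f - scaleCL 0 f \<in> coboundaries (Suc n)"
    by (simp add: coboundaries_def)
qed

lemma is_zero_HL:
  assumes "cocycles n \<subseteq> coboundaries n"
  shows "is_zero_vspace (HL n)"
proof -
  \<comment> \<open>This guarantees that the carrier of the quotient is nonempty.\<close>
  have "0 \<in> cocycles n"
    using C.subspace_0[OF subspace_CL] d_zero_diff by (simp add: cocycles_def)
  moreover have "coset (coboundaries n) f = coboundaries n" if "f \<in> cocycles n" for f
  proof -
    have "coset (coboundaries n) f = coset (coboundaries n) 0"
      using C.coset_eq_iff[OF subspace_coboundaries, of n f 0] that assms by auto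
    then show ?thesis by (simp add: coset_def)
  qed
  ultimately show ?thesis
    unfolding is_zero_vspace_def HL_def quotient_vspace_def by auto
qed

lemma cocycles_0_iff: "f \<in> cocycles 0 \<longleftrightarrow> f \<in> CL 0 \<and> (\<forall>x. f [] \<lhd> x = 0)"
proof -
  have "d 0 f = 0 \<longleftrightarrow> (\<forall>x. f [] \<lhd> x = 0)"
  proof
    assume "d 0 f = 0"
    then have "d 0 f [x] = 0" for x by simp
    then show "\<forall>x. f [] \<lhd> x = 0" by (simp add: d_0)
  qed (simp add: d_0 fun_eq_iff)
  then show ?thesis by (simp add: cocycles_def)
qed

text \<open>For a right invariant \<open>m\<close>, the element \<open>x \<rhd> m\<close> is itself
  a generator of \<open>M0\<close>, so \<open>m\<close> has both weights zero modulo
  \<open>M0\<close>.\<close>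

lemma right_invariants_eq_M0:
  assumes fin: "finite_dimensional_vector_space scaleM Bs"
    and nofac: "\<forall>Q\<in>composition_factors. \<not> has_dim Q 1"
  shows "{m. \<forall>x. m \<lhd> x = 0} = M0"
proof
  show "M0 \<subseteq> {m. \<forall>x. m \<lhd> x = 0}"
    using M0_ract by blast
  show "{m. \<forall>x. m \<lhd> x = 0} \<subseteq> M0"
  proof
    fix m assume m: "m \<in> {m. \<forall>x. m \<lhd> x = 0}"
    show "m \<in> M0"
    proof (rule bimodule_weight_free[OF fin nofac subbimodule_M0])
      show "x \<rhd> m - scaleM 0 m \<in> M0" for x
        using M0_generator[of x m] m by simp
      show "m \<lhd> x - scaleM 0 m \<in> M0" for x
        using M.subspace_0[OF subspace_M0] m by simp
    qed
  qed
qed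

lemma HL_0_iso: "HL 0 \<cong>\<^sub>V vspace_of scaleM {m. \<forall>x. m \<lhd> x = 0}"
proof -
  \<comment> \<open>The coboundaries of degree 0 are \<open>{0}\<close>, so every coset is a
    singleton, and its element is evaluated at the empty list.\<close>
  define \<phi> :: "('l list \<Rightarrow> 'm) set \<Rightarrow> 'm" where "\<phi> A = the_elem A []" for A
  have coset: "coset {0} f = {f}" for f :: "'l list \<Rightarrow> 'm"
    by (auto simp: coset_def)
  have [simp]: "\<phi> {f} = f []" for f by (simp add: \<phi>_def)
  have carrier: "vcarrier (HL 0) = (\<lambda>f. {f}) ` cocycles 0"
    by (simp add: HL_def quotient_vspace_def coboundaries_def coset)
  have "bij_betw \<phi> (vcarrier (HL 0)) {m. \<forall>x. m \<lhd> x = 0}"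
    unfolding bij_betw_def
  proof
    show "inj_on \<phi> (vcarrier (HL 0))"
    proof (rule inj_onI)
      fix A B assume "A \<in> vcarrier (HL 0)" "B \<in> vcarrier (HL 0)" "\<phi> A = \<phi> B"
      then obtain f g where fg: "A = {f}" "B = {g}" "f \<in> cocycles 0" "g \<in> cocycles 0" "\<phi> {f} = \<phi> {g}"
        unfolding carrier by blast
      then have "f = g"
        unfolding cocycles_0_iff CL_0_iff fun_eq_iff by simp metis
      with fg show "A = B" by simp
    qed
    show "\<phi> ` vcarrier (HL 0) = {m. \<forall>x. m \<lhd> x = 0}"
    proof
      show "\<phi> ` vcarrier (HL 0) \<subseteq> {m. \<forall>x. m \<lhd> x = 0}"
        unfolding carrier by (auto simp: cocycles_0_iff)
      show "{m. \<forall>x. m \<lhd> x = 0} \<subseteq> \<phi> ` vcarrier (HL 0)"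
      proof
        fix m assume m: "m \<in> {m. \<forall>x. m \<lhd> x = 0}"
        define f where "f xs = (if xs = [] then m else 0)" for xs :: "'l list"
        have "f \<in> cocycles 0"
          using m by (simp add: cocycles_0_iff CL_0_iff f_def)
        then show "m \<in> \<phi> ` vcarrier (HL 0)"
          unfolding carrier by (intro image_eqI[where x = "{f}"]) (auto simp: f_def)
      qed
    qed
  qed
  moreover have "vadd (HL 0) {f} {g} = {f + g}" "vscale (HL 0) c {f} = {scaleCL c f}" for f g c
    by (simp_all add: HL_def quotient_vspace_def coboundaries_def)
  ultimately show ?thesis
    unfolding vspace_iso_def
    by (intro exI[of _ \<phi>]) (auto simp: vspace_of_def carrier)
qed

end

theorem theorem4p9:
  fixes scaleL :: "'f::alg_closed_field \<Rightarrow> 'l::ab_group_add \<Rightarrow> 'l"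
    and mult :: "'l \<Rightarrow> 'l \<Rightarrow> 'l"
    and scaleM :: "'f \<Rightarrow> 'm::ab_group_add \<Rightarrow> 'm"
    and lact :: "'l \<Rightarrow> 'm \<Rightarrow> 'm"
    and ract :: "'m \<Rightarrow> 'l \<Rightarrow> 'm"
  assumes "left_leibniz_algebra scaleL mult"
    and "left_leibniz_algebra.supersolvable scaleL mult"
    and "leibniz_bimodule scaleL mult scaleM lact ract"
    and "\<exists>B. finite_dimensional_vector_space scaleM B"
    and "\<forall>Q \<in> leibniz_bimodule.composition_factors scaleM lact ract. \<not> has_dim Q 1"
  shows "leibniz_bimodule.HL scaleL mult scaleM lact ract 0
             \<cong>\<^sub>V vspace_of scaleM (leibniz_bimodule.M0 scaleM lact ract)
         \<and> (\<forall>n\<ge>1. is_zero_vspace (leibniz_bimodule.HL scaleL mult scaleM lact ract n))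
         \<and> (leibniz_bimodule.symmetric lact ract \<longrightarrow>
              (\<forall>n. is_zero_vspace (leibniz_bimodule.HL scaleL mult scaleM lact ract n)))"
proof -
  interpret leibniz_bimodule scaleL mult scaleM lact ract by (rule assms(3))
  obtain Bs where fin: "finite_dimensional_vector_space scaleM Bs"
    using assms(4) by blast
  note nofac = assms(5)
  have wf: "weight_free scaleCL \<theta> (CL n)" for n
  proof (induction n)
    case 0
    show ?case by (rule weight_free_CL_0[OF weight_free_lact[OF fin nofac]])
  next
    case (Suc n)
    show ?case by (rule weight_free_CL_Suc[OF assms(2) Suc])
  qed
  have pos: "is_zero_vspace (HL n)" if n: "n \<ge> 1" for n
  proof (rule is_zero_HL)
    obtain m where "n = Suc m" using n by (cases n) auto
    with cocycle_is_coboundary[OF wf] show "cocycles n \<subseteq> coboundaries n" by blast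
  qed
  have sym: "is_zero_vspace (HL 0)" if "symmetric"
  proof (rule is_zero_HL, rule subsetI)
    fix f assume f: "f \<in> cocycles 0"
    \<comment> \<open>Symmetry makes every generator zero, so the right invariants, being
      \<open>M0\<close>, vanish.\<close>
    have "M0 = {0}"
    proof -
      have "{lact x m + ract m x | x m. True} \<subseteq> {0}"
        using that by (auto simp: symmetric_def)
      then show ?thesis
        using M.span_minimal[OF _ M.subspace_single_0] M.subspace_0[OF subspace_M0]
        unfolding M0_def by blast
    qed
    moreover have "f [] \<in> M0"
      using f right_invariants_eq_M0[OF fin nofac] unfolding cocycles_0_iff by blast
    moreover have "f xs = 0" if "xs \<noteq> []" for xs
      using f that unfolding cocycles_0_iff CL_0_iff by blast
    ultimately have "f xs = 0" for xs
      by (cases "xs = []") simp_all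
    then have "f = 0"
      by (simp add: fun_eq_iff)
    then show "f \<in> coboundaries 0"
      by (simp add: coboundaries_def)
  qed
  have "is_zero_vspace (HL n)" if "symmetric" for n
    by (cases "n = 0") (use pos sym that in simp_all)
  with HL_0_iso pos show ?thesis
    unfolding right_invariants_eq_M0[OF fin nofac] by blast
qed

end
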